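(* Let $0\le\beta<1$, let $n$ be a positive integer and $r\ge0$ an integer. Then, as functions of $x\in[0,\infty)$, $$[-\beta x(D+n)+nx+\beta]\,\bigl[n^2T_{n,r+2}^{\beta}(x)-n(r+\beta+1)T_{n,r+1}^{\beta}(x)+\beta(r+2)T_{n,r}^{\beta}(x)\bigr]$$ $$=n\,x^2\,(D+n)\,\bigl[n(1-\beta)T_{n,r+1}^{\beta}(x)+\beta(r+2)T_{n,r}^{\beta}(x)\bigr],$$ where $D=\frac{d}{dx}$.
   Context: For $0\le\beta<1$, a positive integer $n$, an integer $k\ge 0$ and $x\in[0,\infty)$, let $$L_{n,k}^{(\beta)}(x)=\frac{nx(nx+k\beta)^{k-1}}{k!}\,e^{-(nx+k\beta)},$$ where for $k=0$ this is understood as $L_{n,0}^{(\beta)}(x)=e^{-nx}$. Write $\langle f,g\rangle=\int_0^\infty f(t)g(t)\,dt$. For integers $r\ge0$ and $k\ge1$ put $$P_r(k-1;\beta)=\frac{\langle L_{n,k-1}^{(\beta)}(t),t^r\rangle}{\langle L_{n,k-1}^{(\beta)}(t),1\rangle},\qquad T_{n,r}^{\beta}(x)=\sum_{k=1}^{\infty}P_r(k-1;\beta)\,L_{n,k}^{(\beta)}(x).$$ The bracketed expressions involving $D$ are differential operators acting on the functions of $x$ to their right. *)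

theory Defs
  imports "HOL-Analysis.Analysis"
begin

text \<open>
  Generalized Poisson (Jain) basis. The case \<open>k = 0\<close> is the stated convention
  \<open>exp (- n x)\<close>, which also fixes the value at \<open>x = 0\<close>.
\<close>

definition jain_L :: "nat \<Rightarrow> real \<Rightarrow> nat \<Rightarrow> real \<Rightarrow> real" where
  "jain_L n \<beta> k x =
     (if k = 0 then exp (- (real n * x))
      else real n * x * (real n * x + real k * \<beta>) ^ (k - 1) / fact k
             * exp (- (real n * x + real k * \<beta>)))"

definition pairing :: "(real \<Rightarrow> real) \<Rightarrow> (real \<Rightarrow> real) \<Rightarrow> real" where
  "pairing f g = (LINT t:{0..}|lborel. f t * g t)"

definition jain_P :: "nat \<Rightarrow> nat \<Rightarrow> nat \<Rightarrow> real \<Rightarrow> real" where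
  "jain_P n r j \<beta> =
     pairing (jain_L n \<beta> j) (\<lambda>t. t ^ r) / pairing (jain_L n \<beta> j) (\<lambda>t. 1)"

text \<open>The sum over \<open>k \<ge> 1\<close> is reindexed by \<open>k = Suc j\<close>, so that \<open>k - 1 = j\<close>.\<close>

definition jain_T :: "nat \<Rightarrow> nat \<Rightarrow> real \<Rightarrow> real \<Rightarrow> real" where
  "jain_T n r \<beta> x = (\<Sum>j. jain_P n r j \<beta> * jain_L n \<beta> (Suc j) x)"

text \<open>\<open>d/dx\<close> for functions on \<open>[0, \<infinity>)\<close>: two-sided for \<open>x > 0\<close>, one-sided at \<open>0\<close>.\<close>

definition D_half :: "(real \<Rightarrow> real) \<Rightarrow> real \<Rightarrow> real" where
  "D_half f x = vector_derivative f (at x within {0..})"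

definition D_plus :: "real \<Rightarrow> (real \<Rightarrow> real) \<Rightarrow> real \<Rightarrow> real" where
  "D_plus c f x = D_half f x + c * f x"

text \<open>The operator \<open>- \<beta> x (D + n) + n x + \<beta>\<close>.\<close>

definition jain_op :: "nat \<Rightarrow> real \<Rightarrow> (real \<Rightarrow> real) \<Rightarrow> real \<Rightarrow> real" where
  "jain_op n \<beta> f x = - \<beta> * x * D_plus (real n) f x + real n * x * f x + \<beta> * f x"

end

theory Submission
  imports Defs "HOL-Computational_Algebra.Polynomial"
begin

text \<open>
  Write \<open>v = n x + k \<beta>\<close>. Integrating the derivative of \<open>t\<^sup>r\<^sup>+\<^sup>2 (n t + j \<beta>)\<^sup>j e\<^sup>-\<^sup>n\<^sup>t\<close> over the
  half line gives a three-term recurrence for the moments of the basis functions. With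
  \<open>j = k - 1\<close> it says that the coefficients of the combination in the left bracket are \<open>k Q\<^sub>k\<close>,
  where \<open>Q\<^sub>k\<close> are the coefficients of the combination in the right bracket. The identity then holds
  term by term, since \<open>x v (D + n) L\<^sub>k = k (n x + \<beta>) L\<^sub>k\<close>.

  Termwise differentiation is justified because the coefficients grow polynomially in \<open>k\<close>, while
  \<open>k! \<ge> (k / e)\<^sup>k\<close> and \<open>\<beta> e\<^sup>1\<^sup>-\<^sup>\<beta> < 1\<close> make the basis functions decay geometrically, locally
  uniformly in \<open>x\<close>.
\<close>

section \<open>Integrals of a polynomial times an exponential over the half line\<close>

text \<open>A single term of the exponential series is at most the whole sum, all terms being
  nonnegative. The bound serves three times: for integrability, for absorbing powers of k into a
  geometric factor, and, at x = k, as the lower bound (k/e)^k for the factorial.\<close>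

lemma power_le_fact_mult_exp:
  fixes x :: real
  assumes "x \<ge> 0"
  shows "x ^ k \<le> fact k * exp x"
proof -
  have s: "(\<lambda>i. x ^ i /\<^sub>R fact i) sums exp x"
    by (rule exp_converges)
  have "(\<Sum>i\<in>{k}. x ^ i /\<^sub>R fact i) \<le> (\<Sum>i. x ^ i /\<^sub>R fact i)"
    by (rule sum_le_suminf) (use s assms in \<open>auto simp: sums_iff\<close>)
  then have "x ^ k / fact k \<le> exp x"
    using s by (simp add: sums_iff field_simps)
  then show ?thesis
    by (simp add: field_simps)
qed

text \<open>Half of the exponent absorbs the power: t^k exp(-b t) is at most k!/b^k for b = a/2, and
  the remaining factor exp(-b t) is integrable.\<close>

lemma set_integrable_power_exp:
  fixes a :: real
  assumes "a > 0"
  shows "set_integrable lborel {0..} (\<lambda>t. t ^ k * exp (- (a * t)))"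
proof -
  define b where "b = a / 2"
  have b: "b > 0" "a = b + b" using assms by (auto simp: b_def)
  have "(\<lambda>t. exp (- b * t)) absolutely_integrable_on {0..}"
    by (rule nonnegative_absolutely_integrable_1)
       (use integrable_on_exp_minus_to_infinity[OF b(1)] in auto)
  \<comment> \<open>The preceding fact concerns the completed measure; for a Borel function,
    integrability over \<open>lborel\<close> is the same.\<close>
  then have "set_integrable lborel {0..} (\<lambda>t. exp (- b * t))"
    unfolding set_integrable_def by (subst (asm) integrable_completion) auto
  then have dom: "set_integrable lborel {0..} (\<lambda>t. (fact k / b ^ k) * exp (- b * t))"
    by (rule set_integrable_mult_right)
  show ?thesis
  proof (rule set_integrable_bound[OF dom])
    show "AE t in lborel. t \<in> {0..} \<longrightarrow>
        norm (t ^ k * exp (- (a * t))) \<le> norm ((fact k / b ^ k) * exp (- b * t))"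
    proof (intro AE_I2 impI)
      fix t :: real assume "t \<in> {0..}"
      then have t: "t \<ge> 0" by simp
      have "(b * t) ^ k * exp (- (a * t)) \<le> fact k * exp (b * t) * exp (- (a * t))"
        by (intro mult_right_mono power_le_fact_mult_exp) (use b t in auto)
      also have "\<dots> = fact k * exp (- b * t)"
        by (simp add: b(2) mult.assoc mult_exp_exp algebra_simps)
      finally show "norm (t ^ k * exp (- (a * t))) \<le> norm ((fact k / b ^ k) * exp (- b * t))"
        using b t by (simp add: field_simps power_mult_distrib)
    qed
  qed (auto simp: set_borel_measurable_def)
qed

lemma set_integrable_poly_exp:
  fixes a :: real
  assumes "a > 0"
  shows "set_integrable lborel {0..} (\<lambda>t. poly p t * exp (- (a * t)))"
proof -
  have "set_integrable lborel {0..} (\<lambda>t. \<Sum>i\<le>degree p. coeff p i * (t ^ i * exp (- (a * t))))"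
    unfolding set_integrable_def scaleR_sum_right
    by (intro Bochner_Integration.integrable_sum)
       (rule set_integrable_mult_right[OF set_integrable_power_exp[OF assms], unfolded set_integrable_def])
  then show ?thesis
    by (simp add: poly_altdef sum_distrib_right mult.assoc)
qed

lemma tendsto_poly_exp:
  fixes a :: real
  assumes "a > 0"
  shows "((\<lambda>t. poly p t * exp (- (a * t))) \<longlongrightarrow> 0) at_top"
proof -
  have "((\<lambda>t. \<Sum>i\<le>degree p. coeff p i / a ^ i * ((a * t) ^ i / exp (a * t))) \<longlongrightarrow>
          (\<Sum>i\<le>degree p. coeff p i / a ^ i * 0)) at_top"
    by (intro tendsto_intros filterlim_compose[OF tendsto_power_div_exp_0]
         filterlim_tendsto_pos_mult_at_top[OF tendsto_const] assms filterlim_ident)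
  moreover have "coeff p i / a ^ i * ((a * t) ^ i / exp (a * t)) = coeff p i * t ^ i * exp (- (a * t))" for i t
    using assms by (simp add: power_mult_distrib exp_minus field_simps)
  ultimately show ?thesis
    by (simp add: poly_altdef sum_distrib_right)
qed

text \<open>The integrand is the derivative of p(t) exp(-a t), which tends to 0 at infinity, so only
  the boundary value at 0 survives. All moment relations below come from this formula by a choice of
  \<open>p\<close>.\<close>

lemma integral_deriv_poly_exp:
  fixes a :: real
  assumes "a > 0"
  shows "(LINT t:{0..}|lborel. (poly (pderiv p) t - a * poly p t) * exp (- (a * t))) = - poly p 0"
proof -
  let ?f = "\<lambda>t. (poly (pderiv p) t - a * poly p t) * exp (- (a * t))"
  let ?F = "\<lambda>t. poly p t * exp (- (a * t))"
  have int: "set_integrable lborel {0..} ?f"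
    using set_integrable_poly_exp[OF assms, of "pderiv p - smult a p"] by simp
  have meas: "?f \<in> borel_measurable borel"
    by (intro borel_measurable_continuous_onI continuous_intros)
  have "(LBINT x=ereal 0..\<infinity>. ?f x) = 0 - poly p 0"
  proof (rule interval_integral_FTC_integrable[where F = ?F])
    fix x
    have "(?F has_real_derivative ?f x) (at x)"
      by (auto intro!: derivative_eq_intros poly_DERIV simp: algebra_simps)
    then show "(?F has_vector_derivative ?f x) (at x)"
      by (simp add: has_real_derivative_iff_has_vector_derivative)
    show "isCont ?f x" by (intro continuous_intros)
  next
    show "set_integrable lborel (einterval (ereal 0) \<infinity>) ?f"
      by (rule set_integrable_subset[OF int]) (auto simp: einterval_def)
    have "isCont ?F 0" by (intro continuous_intros)
    then have "(?F \<longlongrightarrow> poly p 0) (at 0)"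
      by (simp add: isCont_def)
    then have "(?F \<longlongrightarrow> poly p 0) (at_right 0)"
      by (rule tendsto_within_subset) auto
    then show "((?F \<circ> real_of_ereal) \<longlongrightarrow> poly p 0) (at_right (ereal 0))"
      by (simp add: ereal_tendsto_simps)
    show "((?F \<circ> real_of_ereal) \<longlongrightarrow> 0) (at_left \<infinity>)"
      using tendsto_poly_exp[OF assms, of p] by (simp add: ereal_tendsto_simps)
  qed simp
  then have "(LINT t:{0<..}|lborel. ?f t) = - poly p 0"
    by (simp add: interval_integral_to_infinity_eq)
  \<comment> \<open>The fundamental theorem gives the integral over the open ray; the endpoint 0 is
    a null set.\<close>
  moreover have "(LINT t:{0<..}|lborel. ?f t) = (LINT t:{0..}|lborel. ?f t)"
  proof (rule set_integral_cong_set)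
    show "AE t::real in lborel. (t \<in> {0..}) = (t \<in> {0<..})"
      using AE_lborel_singleton[of "0::real"] by (rule AE_mp) (auto intro!: AE_I2)
  qed (use meas in \<open>auto simp: set_borel_measurable_def intro!: borel_measurable_times borel_measurable_indicator\<close>)
  ultimately show ?thesis by simp
qed

section \<open>Moments of the basis functions\<close>

lemma jain_L_eq_poly_exp:
  obtains q where "\<And>t. jain_L n \<beta> j t = poly q t * exp (- (real n * t))"
proof (rule that)
  fix t
  show "jain_L n \<beta> j t = poly (if j = 0 then 1 else
      smult (exp (- (real j * \<beta>)) / fact j) ([:0, real n:] * [:real j * \<beta>, real n:] ^ (j - 1))) t
      * exp (- (real n * t))"
    by (simp add: jain_L_def exp_diff exp_minus exp_add field_simps)
qed

lemma set_integrable_jain_L_moment: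
  assumes "n \<ge> 1"
  shows "set_integrable lborel {0..} (\<lambda>t. jain_L n \<beta> j t * t ^ r)"
proof -
  obtain q where q: "\<And>t. jain_L n \<beta> j t = poly q t * exp (- (real n * t))"
    using jain_L_eq_poly_exp[of n \<beta> j] by blast
  show ?thesis
    using set_integrable_poly_exp[of "real n" "q * monom 1 r"] assms
    by (simp add: q poly_monom mult_ac)
qed

definition jain_moment :: "nat \<Rightarrow> real \<Rightarrow> nat \<Rightarrow> nat \<Rightarrow> real" where
  "jain_moment n \<beta> j r = pairing (jain_L n \<beta> j) (\<lambda>t. t ^ r)"

lemma jain_P_eq: "jain_P n r j \<beta> = jain_moment n \<beta> j r / jain_moment n \<beta> j 0"
  by (simp add: jain_P_def jain_moment_def)

lemma jain_L_nonneg: "0 \<le> \<beta> \<Longrightarrow> 0 \<le> t \<Longrightarrow> 0 \<le> jain_L n \<beta> j t"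
  by (simp add: jain_L_def)

lemma jain_moment_nonneg:
  assumes "0 \<le> \<beta>"
  shows "0 \<le> jain_moment n \<beta> j r"
  unfolding jain_moment_def pairing_def set_lebesgue_integral_def
  by (rule integral_nonneg_AE) (auto simp: indicator_def jain_L_nonneg assms)

lemma integral_jain_L_combination:
  assumes "n \<ge> 1"
  shows "(LINT t:{0..}|lborel. jain_L n \<beta> j t * (x * t ^ p + y * t ^ q + z * t ^ r)) =
    x * jain_moment n \<beta> j p + y * jain_moment n \<beta> j q + z * jain_moment n \<beta> j r"
proof -
  note J = set_integrable_mult_right[OF set_integrable_jain_L_moment[OF assms, of \<beta> j]]
  have "(LINT t:{0..}|lborel. jain_L n \<beta> j t * (x * t ^ p + y * t ^ q + z * t ^ r)) =
    (LINT t:{0..}|lborel. x * (jain_L n \<beta> j t * t ^ p) + y * (jain_L n \<beta> j t * t ^ q)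
        + z * (jain_L n \<beta> j t * t ^ r))"
    by (simp add: algebra_simps)
  also have "\<dots> = x * jain_moment n \<beta> j p + y * jain_moment n \<beta> j q + z * jain_moment n \<beta> j r"
    unfolding jain_moment_def pairing_def
    by (simp only: set_integral_add(2)[OF set_integral_add(1)[OF J J] J] set_integral_add(2)[OF J J]
        set_integral_mult_right)
  finally show ?thesis .
qed

lemma jain_moment_recurrence:
  assumes "n \<ge> 1"
  shows "(real n)\<^sup>2 * jain_moment n \<beta> j (r + 2) =
    real n * (real r + 2 + real j * (1 - \<beta>)) * jain_moment n \<beta> j (r + 1)
    + (real r + 2) * (real j * \<beta>) * jain_moment n \<beta> j r"
proof -
  define c where "c = real j * \<beta>"
  \<comment> \<open>For j > 0 the power r + 2 leaves the factor t^(r+1) (n t + c)^(j-1) in the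
    derivative, which is exactly what t^r times \<open>jain_L\<close> supplies. It also gives p(0) =
    0, so the recurrence has no boundary term. The constant in front is the normalization of
    \<open>jain_L\<close>.\<close>
  define p where "p = smult (real n * exp (- c) / fact j) (monom 1 (r + 2) * [:c, real n:] ^ j)"
  have eq: "jain_L n \<beta> j t * ((- (real n)\<^sup>2) * t ^ (r + 2)
      + (real n * (real r + 2 + real j * (1 - \<beta>))) * t ^ (r + 1) + ((real r + 2) * c) * t ^ r)
     = (poly (pderiv p) t - real n * poly p t) * exp (- (real n * t))" for t
  proof (cases j)
    case 0
    then show ?thesis
      by (simp add: jain_L_def p_def c_def pderiv_smult pderiv_monom poly_monom
          algebra_simps power2_eq_square)
  next
    case (Suc i)
    have e: "exp (- (real n * t + c)) = exp (- c) * exp (- (real n * t))"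
      by (simp add: exp_diff exp_minus exp_add field_simps)
    have L: "jain_L n \<beta> j t = exp (- c) / fact j * exp (- (real n * t)) * (real n * t * (real n * t + c) ^ i)"
      using Suc e by (simp add: jain_L_def c_def)
    define v where "v = real n * t + c"
    have v: "c + t * real n = v" "v ^ j = v * v ^ i"
      by (simp_all add: v_def Suc)
    have dq: "pderiv ([:c, real n:] ^ j) = smult (real j * real n) ([:c, real n:] ^ i)"
      by (simp add: pderiv_power pderiv_pCons Suc del: power_Suc)
    have p': "poly (pderiv p) t = real n * exp (- c) / fact j *
       (t ^ (r + 2) * (real j * real n * v ^ i) + (real r + 2) * t ^ (r + 1) * (v * v ^ i))"
      by (simp add: p_def pderiv_smult pderiv_mult pderiv_monom poly_monom dq v)
    have p0: "poly p t = real n * exp (- c) / fact j * (t ^ (r + 2) * (v * v ^ i))"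
      by (simp add: p_def poly_monom v)
    \<comment> \<open>This is the comparison of the two sides after removal of the common factors,
      among them \<open>v ^ i\<close>; it is an identity of polynomials in t.\<close>
    have "t * ((- (real n)\<^sup>2) * t ^ (r + 2) + real n * (real r + 2 + real j * (1 - \<beta>)) * t ^ (r + 1) + (real r + 2) * c * t ^ r)
       = t ^ (r + 2) * (real j * real n) + (real r + 2) * t ^ (r + 1) * v - real n * t ^ (r + 2) * v"
      unfolding v_def c_def by (simp add: algebra_simps power2_eq_square)
    then have "real n * exp (- c) / fact j * exp (- (real n * t)) * v ^ i *
        (t * ((- (real n)\<^sup>2) * t ^ (r + 2) + real n * (real r + 2 + real j * (1 - \<beta>)) * t ^ (r + 1) + (real r + 2) * c * t ^ r))
       = real n * exp (- c) / fact j * exp (- (real n * t)) * v ^ i *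
        (t ^ (r + 2) * (real j * real n) + (real r + 2) * t ^ (r + 1) * v - real n * t ^ (r + 2) * v)"
      by (rule arg_cong)
    also have "\<dots> = (poly (pderiv p) t - real n * poly p t) * exp (- (real n * t))"
      unfolding p' p0 by (simp only: algebra_simps)
    finally show ?thesis
      unfolding L v_def[symmetric] by (simp only: mult_ac times_divide_eq_left times_divide_eq_right)
  qed
  have "(LINT t:{0..}|lborel. jain_L n \<beta> j t * ((- (real n)\<^sup>2) * t ^ (r + 2)
      + (real n * (real r + 2 + real j * (1 - \<beta>))) * t ^ (r + 1) + ((real r + 2) * c) * t ^ r)) = - poly p 0"
    unfolding eq by (rule integral_deriv_poly_exp) (use assms in simp)
  then show ?thesis
    unfolding integral_jain_L_combination[OF assms] by (simp add: p_def c_def poly_monom)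
qed

text \<open>The recurrence goes back two orders, so the growth estimate needs starting bounds in
  orders 0 and 1; this one is for order 1. For j > 0 the boundary value of the chosen polynomial
  need not vanish, but its sign is known, whence an inequality.\<close>

lemma jain_moment_1_le:
  assumes "n \<ge> 1" "0 \<le> \<beta>" "\<beta> < 1"
  shows "real n * jain_moment n \<beta> j 1 \<le> (1 + real j * (1 - \<beta>) + \<beta> / (1 - \<beta>)) * jain_moment n \<beta> j 0"
proof (cases j)
  case 0
  \<comment> \<open>For j = 0 the derivative of t exp(-n t) is integrated. The summand with
    coefficient 0 only fits the three-term shape of
    \<open>integral_jain_L_combination\<close>.\<close>
  have "(LINT t:{0..}|lborel. jain_L n \<beta> j t * ((- real n) * t ^ 1 + 1 * t ^ 0 + 0 * t ^ 0)) =
      (LINT t:{0..}|lborel. (poly (pderiv [:0, 1:]) t - real n * poly [:0, 1:] t) * exp (- (real n * t)))"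
    using 0 by (simp add: jain_L_def pderiv_pCons mult_ac)
  also have "\<dots> = 0"
    by (subst integral_deriv_poly_exp) (use assms in auto)
  finally have "real n * jain_moment n \<beta> j 1 = jain_moment n \<beta> j 0"
    unfolding integral_jain_L_combination[OF assms(1)] by simp
  then show ?thesis
    using jain_moment_nonneg[OF assms(2), of n j 0] assms(2,3) 0 by (simp add: algebra_simps)
next
  case (Suc i)
  define c where "c = real j * \<beta>"
  define a where "a = \<beta> / (1 - \<beta>)"
  define K where "K = exp (- c) / fact j"
  \<comment> \<open>The zero \<open>a\<close> of the linear factor is chosen so that the constant term of the derivative
    cancels; no integral of \<open>(n t + c)\<^sup>j\<^sup>-\<^sup>1\<close> without a factor \<open>t\<close> remains.\<close>
  define p where "p = smult K ([:- a, real n:] * [:c, real n:] ^ j)"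
  have "a * (1 - \<beta>) = \<beta>"
    using assms(3) by (simp add: a_def)
  then have "real j * (a * (1 - \<beta>)) = real j * \<beta>"
    by simp
  then have ac: "real j * a - a * c = c"
    by (simp add: algebra_simps c_def)
  have eq: "jain_L n \<beta> j t * ((- (real n)\<^sup>2) * t ^ 1 + (real n * (1 + real j * (1 - \<beta>) + a)) * t ^ 0 + 0 * t ^ 0)
     = (poly (pderiv p) t - real n * poly p t) * exp (- (real n * t))" for t
  proof -
    have e: "exp (- (real n * t + c)) = exp (- c) * exp (- (real n * t))"
      by (simp add: exp_diff exp_minus exp_add field_simps)
    have L: "jain_L n \<beta> j t = K * exp (- (real n * t)) * (real n * t * (real n * t + c) ^ i)"
      using Suc e by (simp add: jain_L_def c_def K_def)
    define v where "v = real n * t + c"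
    have v: "c + t * real n = v" "v ^ j = v * v ^ i"
      by (simp_all add: v_def Suc)
    have dq: "pderiv ([:c, real n:] ^ j) = smult (real j * real n) ([:c, real n:] ^ i)"
      by (simp add: pderiv_power pderiv_pCons Suc del: power_Suc)
    have p': "poly (pderiv p) t = K * (real n * (v * v ^ i) + (real n * t - a) * (real j * real n * v ^ i))"
      by (simp add: p_def pderiv_smult pderiv_mult pderiv_pCons dq v algebra_simps del: mult_pCons_left)
    have p0: "poly p t = K * ((real n * t - a) * (v * v ^ i))"
      by (simp add: p_def v algebra_simps)
    have "real n * t * ((- (real n)\<^sup>2) * t + real n * (1 + real j * (1 - \<beta>) + a))
       = real n * v + (real n * t - a) * real j * real n - real n * (real n * t - a) * v
         + real n * (real j * a - a * c - c)"
      unfolding c_def v_def by (simp add: algebra_simps power2_eq_square)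
    also have "real j * a - a * c - c = 0"
      using ac by simp
    finally have "K * exp (- (real n * t)) * v ^ i *
        (real n * t * ((- (real n)\<^sup>2) * t + real n * (1 + real j * (1 - \<beta>) + a)))
       = K * exp (- (real n * t)) * v ^ i *
        (real n * v + (real n * t - a) * real j * real n - real n * (real n * t - a) * v)"
      by simp
    also have "\<dots> = (poly (pderiv p) t - real n * poly p t) * exp (- (real n * t))"
      unfolding p' p0 by (simp only: algebra_simps)
    finally show ?thesis
      unfolding L v_def[symmetric] by (simp only: mult_ac power_0 power_one_right mult_zero_left add_0_right mult_1_left)
  qed
  have "(LINT t:{0..}|lborel. jain_L n \<beta> j t * ((- (real n)\<^sup>2) * t ^ 1 + (real n * (1 + real j * (1 - \<beta>) + a)) * t ^ 0 + 0 * t ^ 0))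
      = - poly p 0"
    unfolding eq by (rule integral_deriv_poly_exp) (use assms in simp)
  also have "\<dots> = K * (a * c ^ j)"
    by (simp add: p_def)
  also have "\<dots> \<ge> 0"
    using assms by (simp add: K_def a_def c_def)
  finally have "real n * (real n * jain_moment n \<beta> j 1) \<le> real n * ((1 + real j * (1 - \<beta>) + a) * jain_moment n \<beta> j 0)"
    unfolding integral_jain_L_combination[OF assms(1)] by (simp add: algebra_simps power2_eq_square)
  then show ?thesis
    using assms(1) by (simp add: a_def)
qed

section \<open>Polynomial growth of the coefficients\<close>

text \<open>The base j + 1 is at least 1, so exponents may be enlarged when two bounds are added.
  Nonnegativity of \<open>C\<close> is not demanded, since it follows from the case j = 0.\<close>

definition poly_growth :: "(nat \<Rightarrow> real) \<Rightarrow> bool" where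
  "poly_growth c \<longleftrightarrow> (\<exists>C m. \<forall>j. \<bar>c j\<bar> \<le> C * (real j + 1) ^ m)"

lemma poly_growth_const: "poly_growth (\<lambda>j. a)"
  unfolding poly_growth_def by (rule exI[of _ "\<bar>a\<bar>"], rule exI[of _ 0]) simp

lemma poly_growth_of_nat: "poly_growth real"
  unfolding poly_growth_def by (rule exI[of _ 1], rule exI[of _ 1]) simp

lemma poly_growth_add:
  assumes "poly_growth c" "poly_growth d"
  shows "poly_growth (\<lambda>j. c j + d j)"
proof -
  obtain C m where C: "\<And>j. \<bar>c j\<bar> \<le> C * (real j + 1) ^ m"
    using assms(1) by (auto simp: poly_growth_def)
  obtain D l where D: "\<And>j. \<bar>d j\<bar> \<le> D * (real j + 1) ^ l"
    using assms(2) by (auto simp: poly_growth_def)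
  have pos: "0 \<le> C" "0 \<le> D"
    using order_trans[OF abs_ge_zero C[of 0]] order_trans[OF abs_ge_zero D[of 0]] by auto
  have "\<bar>c j + d j\<bar> \<le> (C + D) * (real j + 1) ^ (m + l)" for j
  proof -
    have "C * (real j + 1) ^ m \<le> C * (real j + 1) ^ (m + l)"
      "D * (real j + 1) ^ l \<le> D * (real j + 1) ^ (m + l)"
      by (intro mult_left_mono power_increasing pos; simp)+
    then show ?thesis
      using C[of j] D[of j] by (simp add: distrib_right)
  qed
  then show ?thesis
    unfolding poly_growth_def by blast
qed

lemma poly_growth_mult:
  assumes "poly_growth c" "poly_growth d"
  shows "poly_growth (\<lambda>j. c j * d j)"
proof -
  obtain C m where C: "\<And>j. \<bar>c j\<bar> \<le> C * (real j + 1) ^ m"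
    using assms(1) by (auto simp: poly_growth_def)
  obtain D l where D: "\<And>j. \<bar>d j\<bar> \<le> D * (real j + 1) ^ l"
    using assms(2) by (auto simp: poly_growth_def)
  have "\<bar>c j * d j\<bar> \<le> (C * D) * (real j + 1) ^ (m + l)" for j
    using mult_mono'[OF C[of j] D[of j]] by (simp add: abs_mult power_add mult_ac)
  then show ?thesis
    unfolding poly_growth_def by blast
qed

lemmas poly_growth_intros =
  poly_growth_const poly_growth_of_nat poly_growth_add poly_growth_mult

lemma poly_growth_mono:
  assumes "poly_growth d" "\<And>j. \<bar>c j\<bar> \<le> d j"
  shows "poly_growth c"
  using assms unfolding poly_growth_def by (meson abs_ge_self order_trans)

text \<open>The moment recurrence is divided by the common denominator, the zeroth moment. Were that
  0, all the quotients would be 0 and the equation would still hold.\<close>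

lemma jain_P_recurrence:
  assumes "n \<ge> 1"
  shows "(real n)\<^sup>2 * jain_P n (r + 2) j \<beta> =
    real n * (real r + 2 + real j * (1 - \<beta>)) * jain_P n (r + 1) j \<beta>
    + (real r + 2) * (real j * \<beta>) * jain_P n r j \<beta>"
  unfolding jain_P_eq times_divide_eq_right add_divide_distrib[symmetric]
    jain_moment_recurrence[OF assms] ..

lemma poly_growth_jain_P:
  assumes "n \<ge> 1" "0 \<le> \<beta>" "\<beta> < 1"
  shows "poly_growth (\<lambda>j. jain_P n r j \<beta>)"
proof -
  have "\<bar>jain_P n 1 j \<beta>\<bar> \<le> (1 + \<beta> / (1 - \<beta>)) + (1 - \<beta>) * real j" for j
  proof -
    have "1 * jain_moment n \<beta> j 1 \<le> real n * jain_moment n \<beta> j 1"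
      by (intro mult_right_mono jain_moment_nonneg) (use assms in auto)
    also note jain_moment_1_le[OF assms]
    finally have le: "jain_moment n \<beta> j 1 \<le> (1 + real j * (1 - \<beta>) + \<beta> / (1 - \<beta>)) * jain_moment n \<beta> j 0"
      by simp
    have nn: "0 \<le> (1 + \<beta> / (1 - \<beta>)) + (1 - \<beta>) * real j"
      using assms by simp
    show ?thesis
    \<comment> \<open>A zero denominator makes the quotient 0 by the convention on division, so
      strict positivity of the zeroth moment does not have to be shown.\<close>
    proof (cases "jain_moment n \<beta> j 0 = 0")
      case True
      then show ?thesis using nn by (simp add: jain_P_eq)
    next
      case False
      then have "jain_moment n \<beta> j 0 > 0"
        using jain_moment_nonneg[OF assms(2), of n j 0] by simp
      then show ?thesis
        using le jain_moment_nonneg[OF assms(2), of n j 1]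
        by (simp only: jain_P_eq abs_of_nonneg divide_nonneg_nonneg pos_divide_le_eq less_imp_le)
           (simp add: algebra_simps)
    qed
  qed
  then have base1: "poly_growth (\<lambda>j. jain_P n 1 j \<beta>)"
    by (rule poly_growth_mono[rotated]) (intro poly_growth_intros)
  \<comment> \<open>Two consecutive orders are carried through the induction because the recurrence
    uses both.\<close>
  have "poly_growth (\<lambda>j. jain_P n r j \<beta>) \<and> poly_growth (\<lambda>j. jain_P n (r + 1) j \<beta>)"
  proof (induction r)
    case 0
    have "poly_growth (\<lambda>j. jain_P n 0 j \<beta>)"
      by (rule poly_growth_mono[OF poly_growth_const[of 1]]) (simp add: jain_P_eq)
    then show ?case using base1 by simp
  next
    case (Suc r)
    have "jain_P n (r + 2) j \<beta> = (1 / (real n)\<^sup>2) *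
       (real n * (real r + 2 + real j * (1 - \<beta>)) * jain_P n (r + 1) j \<beta>
        + (real r + 2) * (real j * \<beta>) * jain_P n r j \<beta>)" for j
      unfolding jain_P_recurrence[OF assms(1), symmetric] using assms(1) by simp
    then have "(\<lambda>j. jain_P n (r + 2) j \<beta>) = (\<lambda>j. (1 / (real n)\<^sup>2) *
       (real n * (real r + 2 + real j * (1 - \<beta>)) * jain_P n (r + 1) j \<beta>
        + (real r + 2) * (real j * \<beta>) * jain_P n r j \<beta>))"
      by blast
    moreover have "poly_growth \<dots>"
      using Suc by (intro poly_growth_intros) simp_all
    ultimately show ?case using Suc by simp
  qed
  then show ?thesis ..
qed

section \<open>Summable majorants\<close>

text \<open>With q = exp(-2 d), one factor exp(-d k) absorbs the polynomial and the other leaves a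
  geometric series.\<close>

lemma summable_power_times_geometric:
  fixes q :: real
  assumes "0 < q" "q < 1"
  shows "summable (\<lambda>k. (real k + 1) ^ m * q ^ k)"
proof -
  define d where "d = - ln q / 2"
  have d: "d > 0" using assms by (simp add: d_def)
  have q: "q = exp (- d) * exp (- d)"
    using assms by (simp add: mult_exp_exp d_def)
  have "summable (\<lambda>k. (fact m * exp d / d ^ m) * exp (- d) ^ k)"
    by (intro summable_mult summable_geometric) (use d in simp)
  then show ?thesis
  proof (rule summable_comparison_test'[where N = 0])
    fix k :: nat
    define w where "w = real k + 1"
    have "(d * w) ^ m * q ^ k \<le> fact m * exp (d * w) * q ^ k"
      by (intro mult_right_mono power_le_fact_mult_exp) (use d assms in \<open>auto simp: w_def\<close>)
    also have "\<dots> = fact m * exp d * exp (- d) ^ k"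
      unfolding q exp_of_nat_mult[symmetric] power_mult_distrib w_def
      by (simp add: mult.assoc mult_exp_exp algebra_simps)
    finally have "w ^ m * q ^ k \<le> (fact m * exp d / d ^ m) * exp (- d) ^ k"
      using d by (simp add: power_mult_distrib field_simps)
    then show "norm ((real k + 1) ^ m * q ^ k) \<le> (fact m * exp d / d ^ m) * exp (- d) ^ k"
      using assms by (simp add: w_def)
  qed
qed

text \<open>By k^k <= k! e^k the factor after the power of k + 1 is at most the k-th power of (R/k +
  \<beta>) exp(1 - \<beta>). This base tends to \<beta> exp(1 - \<beta>) < 1, so it is eventually
  below a fixed q < 1. Here \<open>R\<close> stands for a bound on n|x|.\<close>

lemma summable_jain_majorant:
  fixes \<beta> R :: real
  assumes "0 \<le> \<beta>" "\<beta> < 1" "0 \<le> R"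
  shows "summable (\<lambda>k. (real k + 1) ^ m * ((R + real k * \<beta>) ^ k * exp (- (real k * \<beta>)) / fact k))"
proof -
  \<comment> \<open>Squaring \<open>1 + y \<le> exp y\<close> at \<open>y = (\<beta> - 1) / 2\<close> makes the bound \<open>\<beta> < exp (\<beta> - 1)\<close> strict.\<close>
  have "((1 + \<beta>) / 2)\<^sup>2 \<le> (exp ((\<beta> - 1) / 2))\<^sup>2"
    using exp_ge_add_one_self[of "(\<beta> - 1) / 2"] assms by (intro power_mono) (auto simp: field_simps)
  also have "\<dots> = exp (\<beta> - 1)"
    by (simp flip: exp_of_nat_mult)
  finally have "((1 + \<beta>) / 2)\<^sup>2 \<le> exp (\<beta> - 1)" .
  moreover have "0 < ((1 - \<beta>) / 2)\<^sup>2"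
    using assms by simp
  moreover have "((1 + \<beta>) / 2)\<^sup>2 - ((1 - \<beta>) / 2)\<^sup>2 = \<beta>"
    by (simp add: power2_eq_square field_simps)
  ultimately have "\<beta> < exp (\<beta> - 1)"
    by linarith
  then have lt1: "\<beta> * exp (1 - \<beta>) < 1"
    by (simp add: exp_diff field_simps)
  then obtain q where q: "\<beta> * exp (1 - \<beta>) < q" "q < 1"
    using dense by blast
  have "0 \<le> \<beta> * exp (1 - \<beta>)" using assms by simp
  then have q0: "0 < q" using q by linarith
  have "((\<lambda>k. (R / real k + \<beta>) * exp (1 - \<beta>)) \<longlonglongrightarrow> (0 + \<beta>) * exp (1 - \<beta>))"
    by (intro tendsto_intros lim_const_over_n)
  then have ev: "\<forall>\<^sub>F k in sequentially. (R / real k + \<beta>) * exp (1 - \<beta>) < q"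
    by (rule order_tendstoD) (use q in simp)
  show ?thesis
  proof (rule summable_comparison_test_ev[OF _ summable_power_times_geometric[OF q0 q(2), of m]])
    show "\<forall>\<^sub>F k in sequentially.
       norm ((real k + 1) ^ m * ((R + real k * \<beta>) ^ k * exp (- (real k * \<beta>)) / fact k))
       \<le> (real k + 1) ^ m * q ^ k"
      using ev eventually_gt_at_top[of 0]
    proof eventually_elim
      case (elim k)
      then have k: "real k > 0" by simp
      have f: "real k ^ k \<le> fact k * exp (real k)"
        by (rule power_le_fact_mult_exp) simp
      have "(R + real k * \<beta>) ^ k * exp (- (real k * \<beta>))
          = (R / real k + \<beta>) ^ k * exp (- (real k * \<beta>)) * real k ^ k"
        using k by (simp add: power_mult_distrib[symmetric] field_simps)
      also have "\<dots> \<le> (R / real k + \<beta>) ^ k * exp (- (real k * \<beta>)) * (fact k * exp (real k))"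
        using f assms by (intro mult_left_mono) auto
      also have "\<dots> = fact k * ((R / real k + \<beta>) ^ k * (exp (1 - \<beta>)) ^ k)"
        by (simp add: exp_of_nat_mult[symmetric] mult_exp_exp algebra_simps)
      also have "\<dots> = fact k * ((R / real k + \<beta>) * exp (1 - \<beta>)) ^ k"
        by (simp only: power_mult_distrib)
      also have "\<dots> \<le> fact k * q ^ k"
        using elim assms by (intro mult_left_mono power_mono) auto
      finally have "(R + real k * \<beta>) ^ k * exp (- (real k * \<beta>)) / fact k \<le> q ^ k"
        by (simp add: field_simps)
      then have "(real k + 1) ^ m * ((R + real k * \<beta>) ^ k * exp (- (real k * \<beta>)) / fact k)
          \<le> (real k + 1) ^ m * q ^ k"
        by (rule mult_left_mono) simp
      moreover have "0 \<le> (real k + 1) ^ m * ((R + real k * \<beta>) ^ k * exp (- (real k * \<beta>)) / fact k)"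
        using assms by simp
      ultimately show ?case
        by (simp only: real_norm_def abs_of_nonneg)
    qed
  qed
qed

section \<open>The derivative of the basis functions\<close>

text \<open>The index is shifted: \<open>j\<close> belongs to the basis function of index j + 1. At
  j = 0 the truncated exponent j - 1 is harmless because of the factor j.\<close>

definition jain_dL :: "nat \<Rightarrow> real \<Rightarrow> nat \<Rightarrow> real \<Rightarrow> real" where
  "jain_dL n \<beta> j x = (let v = real n * x + real (Suc j) * \<beta> in
     real n * (v ^ j + real n * x * (real j * v ^ (j - 1)) - real n * x * v ^ j) / fact (Suc j) * exp (- v))"

lemma has_real_derivative_jain_L:
  "(jain_L n \<beta> (Suc j) has_real_derivative jain_dL n \<beta> j x) (at x)"
  unfolding jain_L_def jain_dL_def Let_def
  by (auto intro!: derivative_eq_intros simp del: fact_Suc simp: field_simps)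

text \<open>Adding n times the function cancels the contribution of the exponential, so only the
  product rule for x v^j remains. After multiplication by v it yields v + j n x = (j + 1)(n x +
  \<beta>) as a factor. Multiplying by x and v, instead of dividing, keeps the points where they
  vanish.\<close>

lemma jain_L_dL_identity:
  "x * (real n * x + real (Suc j) * \<beta>) * (jain_dL n \<beta> j x + real n * jain_L n \<beta> (Suc j) x)
   = real (Suc j) * (real n * x + \<beta>) * jain_L n \<beta> (Suc j) x"
proof -
  define v where "v = real n * x + real (Suc j) * \<beta>"
  have L: "jain_L n \<beta> (Suc j) x = real n * x * v ^ j / fact (Suc j) * exp (- v)"
    by (simp add: jain_L_def v_def)
  have dL: "jain_dL n \<beta> j x + real n * jain_L n \<beta> (Suc j) x =
     real n * (v ^ j + real n * x * (real j * v ^ (j - 1))) / fact (Suc j) * exp (- v)"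
    unfolding L jain_dL_def Let_def v_def[symmetric]
    by (simp add: add_divide_distrib diff_divide_distrib algebra_simps del: fact_Suc)
  have "v * (v ^ j + real n * x * (real j * v ^ (j - 1))) = (v + real n * x * real j) * v ^ j"
    by (cases j) (simp_all add: algebra_simps)
  also have "v + real n * x * real j = real (Suc j) * (real n * x + \<beta>)"
    by (simp add: v_def algebra_simps)
  finally have "v * (v ^ j + real n * x * (real j * v ^ (j - 1))) = real (Suc j) * (real n * x + \<beta>) * v ^ j" .
  then have "x * real n / fact (Suc j) * exp (- v) * (v * (v ^ j + real n * x * (real j * v ^ (j - 1))))
      = x * real n / fact (Suc j) * exp (- v) * (real (Suc j) * (real n * x + \<beta>) * v ^ j)"
    by (rule arg_cong)
  then show ?thesis
    unfolding dL unfolding v_def[symmetric] unfolding L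
    by (simp only: times_divide_eq_left times_divide_eq_right mult_ac)
qed

text \<open>The number S = R + (j + 1)\<beta> dominates both |n x| and |v|, and S >= 1 lets every
  power be raised to S^(j+1). The factor j + 2 adds up the weights 1, j and 1 of the three terms of
  the derivative, and exp(R) bounds exp(-n x) for either sign of x.\<close>

lemma jain_L_dL_bounds:
  fixes R :: real
  assumes "0 \<le> \<beta>" "1 \<le> R" "real n * \<bar>x\<bar> \<le> R"
  defines "M \<equiv> \<lambda>k. (R + real k * \<beta>) ^ k * exp (- (real k * \<beta>)) / fact k"
  shows "\<bar>jain_L n \<beta> (Suc j) x\<bar> \<le> exp R * M (Suc j)"
    and "\<bar>jain_dL n \<beta> j x\<bar> \<le> real n * exp R * (real j + 2) * M (Suc j)"
proof -
  define u where "u = real n * x"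
  define c where "c = real (Suc j) * \<beta>"
  define S where "S = R + c"
  have c: "c \<ge> 0" using assms by (simp add: c_def)
  have u: "\<bar>u\<bar> \<le> R" using assms by (simp add: u_def abs_mult)
  have S: "S \<ge> 1" "R \<le> S" "\<bar>u + c\<bar> \<le> S" using u c assms by (auto simp: S_def)
  have pow: "\<bar>u + c\<bar> ^ i \<le> S ^ i" for i using S by (intro power_mono) auto
  have e: "exp (- (u + c)) \<le> exp R * exp (- c)"
    using u by (simp add: mult_exp_exp)
  have M: "M (Suc j) = S ^ Suc j * exp (- c) / fact (Suc j)"
    by (simp add: M_def S_def c_def)
  have b1: "\<bar>u\<bar> * \<bar>u + c\<bar> ^ j \<le> S ^ Suc j"
    unfolding power_Suc using u S pow by (intro mult_mono) auto
  have b2: "\<bar>u + c\<bar> ^ j \<le> S ^ Suc j"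
    using pow[of j] S power_increasing[of j "Suc j" S] by linarith
  have b3: "\<bar>u\<bar> * (real j * \<bar>u + c\<bar> ^ (j - 1)) \<le> real j * S ^ Suc j"
  proof (cases j)
    case (Suc i)
    have "\<bar>u\<bar> * \<bar>u + c\<bar> ^ i \<le> S * S ^ i"
      using u S pow by (intro mult_mono) auto
    also have "\<dots> \<le> S ^ Suc (Suc i)"
      using S power_increasing[of "Suc i" "Suc (Suc i)" S] by simp
    finally have "real j * (\<bar>u\<bar> * \<bar>u + c\<bar> ^ i) \<le> real j * S ^ Suc (Suc i)"
      by (rule mult_left_mono) simp
    then show ?thesis by (simp only: Suc diff_Suc_1 mult_ac)
  qed simp
  have "\<bar>jain_L n \<beta> (Suc j) x\<bar> = (\<bar>u\<bar> * \<bar>u + c\<bar> ^ j) / fact (Suc j) * exp (- (u + c))"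
    by (simp add: jain_L_def u_def c_def abs_mult power_abs)
  also have "\<dots> \<le> S ^ Suc j / fact (Suc j) * (exp R * exp (- c))"
    by (intro mult_mono divide_right_mono b1 e) (use S in auto)
  finally show "\<bar>jain_L n \<beta> (Suc j) x\<bar> \<le> exp R * M (Suc j)"
    by (simp add: M mult_ac)
  let ?A = "(u + c) ^ j + u * (real j * (u + c) ^ (j - 1)) - u * (u + c) ^ j"
  have "\<bar>?A\<bar> \<le> \<bar>(u + c) ^ j\<bar> + \<bar>u * (real j * (u + c) ^ (j - 1))\<bar> + \<bar>u * (u + c) ^ j\<bar>"
    by linarith
  also have "\<dots> \<le> S ^ Suc j + real j * S ^ Suc j + S ^ Suc j"
    using b1 b2 b3 by (simp only: abs_mult power_abs abs_of_nat)
  finally have A: "\<bar>?A\<bar> \<le> (real j + 2) * S ^ Suc j"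
    by (simp only: algebra_simps) 
  have "\<bar>jain_dL n \<beta> j x\<bar> = real n * (\<bar>?A\<bar> / fact (Suc j) * exp (- (u + c)))"
    by (simp add: jain_dL_def Let_def u_def c_def abs_mult del: of_nat_Suc fact_Suc)
  also have "\<dots> \<le> real n * ((real j + 2) * S ^ Suc j / fact (Suc j) * (exp R * exp (- c)))"
    by (intro mult_left_mono mult_mono divide_right_mono A e) (use S in auto)
  finally show "\<bar>jain_dL n \<beta> j x\<bar> \<le> real n * exp R * (real j + 2) * M (Suc j)"
    by (simp add: M mult_ac del: power_Suc fact_Suc)
qed

section \<open>Termwise differentiation of series in the basis functions\<close>

context
  fixes n :: nat and \<beta> :: real and c :: "nat \<Rightarrow> real"
  assumes \<beta>: "0 \<le> \<beta>" "\<beta> < 1" and c: "poly_growth c"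
begin

text \<open>One majorant serves the series and its derivative, uniformly on a symmetric interval.
  Negative x are included so that 0 becomes an interior point.\<close>

lemma jain_series_majorant:
  assumes "0 \<le> B"
  obtains M where "summable M"
    "\<And>j x. \<bar>x\<bar> \<le> B \<Longrightarrow> \<bar>c j * jain_L n \<beta> (Suc j) x\<bar> \<le> M j"
    "\<And>j x. \<bar>x\<bar> \<le> B \<Longrightarrow> \<bar>c j * jain_dL n \<beta> j x\<bar> \<le> M j"
proof -
  obtain C m where C: "\<And>j. \<bar>c j\<bar> \<le> C * (real j + 1) ^ m"
    using c by (auto simp: poly_growth_def)
  have C0: "C \<ge> 0" using order_trans[OF abs_ge_zero C[of 0]] by simp
  define R where "R = real n * B + 1"
  have R: "R \<ge> 1" using assms by (simp add: R_def)
  define G where "G = (\<lambda>k. (R + real k * \<beta>) ^ k * exp (- (real k * \<beta>)) / fact k)"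
  have G: "G k \<ge> 0" for k using R \<beta> by (simp add: G_def)
  \<comment> \<open>The factor n + 1 covers the constants 1 and n of the two basis bounds; the
    additional power of j + 2 comes from the bound for the derivative.\<close>
  define M where "M = (\<lambda>j. C * (real n + 1) * exp R * ((real (Suc j) + 1) ^ (m + 1) * G (Suc j)))"
  have "summable (\<lambda>k. (real k + 1) ^ (m + 1) * G k)"
    unfolding G_def by (rule summable_jain_majorant) (use \<beta> R in auto)
  then have "summable (\<lambda>j. (real (Suc j) + 1) ^ (m + 1) * G (Suc j))"
    by (subst summable_Suc_iff)
  then have "summable M"
    unfolding M_def by (rule summable_mult)
  have cj: "\<bar>c j\<bar> \<le> C * (real j + 2) ^ m" for j
    using C[of j] C0 by (meson add_left_mono mult_left_mono of_nat_0_le_iff one_le_numeral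
        order_trans power_mono add_nonneg_nonneg zero_le_one)
  have le: "\<bar>c j\<bar> * ((real n + 1) * exp R * (real j + 2) * G (Suc j)) \<le> M j" for j
  proof -
    have "\<bar>c j\<bar> * ((real n + 1) * exp R * (real j + 2) * G (Suc j))
        \<le> C * (real j + 2) ^ m * ((real n + 1) * exp R * (real j + 2) * G (Suc j))"
      by (intro mult_right_mono cj) (use G in auto)
    then show ?thesis by (simp add: M_def mult_ac add_ac)
  qed
  show ?thesis
  proof
    fix j :: nat and x :: real
    assume "\<bar>x\<bar> \<le> B"
    then have x: "real n * \<bar>x\<bar> \<le> R"
      unfolding R_def by (simp add: mult_left_mono add_increasing2)
    have b: "\<bar>jain_L n \<beta> (Suc j) x\<bar> \<le> exp R * G (Suc j)"
      "\<bar>jain_dL n \<beta> j x\<bar> \<le> real n * exp R * (real j + 2) * G (Suc j)"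
      unfolding G_def by (rule jain_L_dL_bounds[OF \<beta>(1) R x])+
    have "1 \<le> (real n + 1) * (real j + 2)"
      using mult_mono[of 1 "real n + 1" 1 "real j + 2"] by simp
    then have "exp R * G (Suc j) \<le> (real n + 1) * (real j + 2) * (exp R * G (Suc j))"
      using mult_right_mono[of 1 "(real n + 1) * (real j + 2)" "exp R * G (Suc j)"] G by simp
    then have b1: "\<bar>jain_L n \<beta> (Suc j) x\<bar> \<le> (real n + 1) * exp R * (real j + 2) * G (Suc j)"
      by (intro order_trans[OF b(1)]) (simp add: mult_ac)
    have "real n * (exp R * (real j + 2) * G (Suc j)) \<le> (real n + 1) * (exp R * (real j + 2) * G (Suc j))"
      using G[of "Suc j"] by (intro mult_right_mono) auto
    then have b2: "\<bar>jain_dL n \<beta> j x\<bar> \<le> (real n + 1) * exp R * (real j + 2) * G (Suc j)"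
      by (intro order_trans[OF b(2)]) (simp add: mult_ac)
    show "\<bar>c j * jain_L n \<beta> (Suc j) x\<bar> \<le> M j"
      unfolding abs_mult by (rule order_trans[OF mult_left_mono[OF b1] le]) simp
    show "\<bar>c j * jain_dL n \<beta> j x\<bar> \<le> M j"
      unfolding abs_mult by (rule order_trans[OF mult_left_mono[OF b2] le]) simp
  qed fact
qed

lemma summable_jain_series: "summable (\<lambda>j. c j * jain_L n \<beta> (Suc j) x)"
  and summable_jain_series_deriv: "summable (\<lambda>j. c j * jain_dL n \<beta> j x)"
proof -
  obtain M where "summable M"
    "\<And>j. \<bar>c j * jain_L n \<beta> (Suc j) x\<bar> \<le> M j" "\<And>j. \<bar>c j * jain_dL n \<beta> j x\<bar> \<le> M j"
    using jain_series_majorant[of "\<bar>x\<bar>"] by (metis abs_ge_zero order_refl)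
  then show "summable (\<lambda>j. c j * jain_L n \<beta> (Suc j) x)" "summable (\<lambda>j. c j * jain_dL n \<beta> j x)"
    by (auto intro: summable_comparison_test'[where N = 0])
qed

text \<open>The ball of radius |x| + 1 about 0 has x in its interior, and on it the differentiated
  series converges uniformly by the Weierstrass test.\<close>

lemma has_real_derivative_jain_series:
  "((\<lambda>x. \<Sum>j. c j * jain_L n \<beta> (Suc j) x) has_real_derivative (\<Sum>j. c j * jain_dL n \<beta> j x)) (at x)"
proof -
  obtain M where M: "summable M"
    "\<And>j y. \<bar>y\<bar> \<le> \<bar>x\<bar> + 1 \<Longrightarrow> \<bar>c j * jain_dL n \<beta> j y\<bar> \<le> M j"
    using jain_series_majorant[of "\<bar>x\<bar> + 1"] by (metis abs_ge_zero add_nonneg_nonneg zero_le_one)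
  show ?thesis
  proof (rule has_field_derivative_series'(2)[where S = "ball 0 (\<bar>x\<bar> + 1)" and ?x0.0 = x
        and f = "\<lambda>j x. c j * jain_L n \<beta> (Suc j) x"
        and f' = "\<lambda>j x. c j * jain_dL n \<beta> j x"])
    show "uniformly_convergent_on (ball 0 (\<bar>x\<bar> + 1)) (\<lambda>k y. \<Sum>j<k. c j * jain_dL n \<beta> j y)"
      by (rule Weierstrass_m_test'[OF _ M(1)]) (use M(2) in \<open>auto simp: dist_real_def\<close>)
  qed (auto simp: summable_jain_series
        intro!: DERIV_cmult has_field_derivative_at_within[OF has_real_derivative_jain_L])
qed

text \<open>The series is differentiable on the whole line, so its two-sided derivative is also the
  derivative within the half line, at 0 as well. Uniqueness of the latter requires that x be a limit
  point of the half line.\<close>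

lemma D_half_jain_series:
  assumes "x \<ge> 0"
  shows "D_half (\<lambda>x. \<Sum>j. c j * jain_L n \<beta> (Suc j) x) x = (\<Sum>j. c j * jain_dL n \<beta> j x)"
proof -
  have "x islimpt {0..x + 1}"
    using assms by (intro connected_imp_perfect) auto
  then have "at x within {0..} \<noteq> bot"
    unfolding trivial_limit_within using islimpt_subset[of x "{0..x+1}" "{0..}"] by auto
  then show ?thesis
    unfolding D_half_def
    by (intro vector_derivative_within)
       (auto intro!: has_field_derivative_at_within has_real_derivative_jain_series
         simp flip: has_real_derivative_iff_has_vector_derivative)
qed

end

section \<open>The identity for the operators\<close>

theorem lemma7:
  fixes \<beta> :: real and n r :: nat
  assumes "0 \<le> \<beta>" and "\<beta> < 1" and "n \<ge> 1"
  shows "(\<forall>s\<in>{r, r + 1, r + 2}.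
            (\<forall>x\<ge>0. summable (\<lambda>j. jain_P n s j \<beta> * jain_L n \<beta> (Suc j) x)) \<and>
            jain_T n s \<beta> differentiable_on {0..}) \<and>
         (\<forall>x\<ge>0.
            jain_op n \<beta>
              (\<lambda>y. (real n)\<^sup>2 * jain_T n (r + 2) \<beta> y
                   - real n * (real r + \<beta> + 1) * jain_T n (r + 1) \<beta> y
                   + \<beta> * (real r + 2) * jain_T n r \<beta> y) x
            = real n * x\<^sup>2 *
              D_plus (real n)
                (\<lambda>y. real n * (1 - \<beta>) * jain_T n (r + 1) \<beta> y
                     + \<beta> * (real r + 2) * jain_T n r \<beta> y) x)"
proof -
  note growth = poly_growth_jain_P[OF assms(3,1,2)]
  note S = summable_jain_series[OF assms(1,2)]
  note S' = summable_jain_series_deriv[OF assms(1,2)]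
  define Q where "Q = (\<lambda>j. real n * (1 - \<beta>) * jain_P n (r + 1) j \<beta> + \<beta> * (real r + 2) * jain_P n r j \<beta>)"
  define K where "K = (\<lambda>j. (1 + real j) * Q j)"
  have gQ: "poly_growth Q" unfolding Q_def by (intro poly_growth_intros growth)
  have gK: "poly_growth K" unfolding K_def by (intro poly_growth_intros gQ)
  \<comment> \<open>Once the recurrence has replaced order r + 2, the coefficient of order r + 1 is
    n times (r + 2 + j(1 - \<beta>)) - (r + \<beta> + 1) = (j + 1)(1 - \<beta>), and that of order r
    is (j + 1)\<beta>(r + 2). Thus j + 1 factors out.\<close>
  have K: "K j = (real n)\<^sup>2 * jain_P n (r + 2) j \<beta> - real n * (real r + \<beta> + 1) * jain_P n (r + 1) j \<beta>
      + \<beta> * (real r + 2) * jain_P n r j \<beta>" for j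
    unfolding jain_P_recurrence[OF assms(3)] K_def Q_def by (simp add: algebra_simps)
  have sT: "(\<lambda>j. a * (jain_P n s j \<beta> * jain_L n \<beta> (Suc j) x)) sums (a * jain_T n s \<beta> x)" for a s x
    unfolding jain_T_def by (intro sums_mult summable_sums S growth)
  have right: "(\<lambda>y. real n * (1 - \<beta>) * jain_T n (r + 1) \<beta> y + \<beta> * (real r + 2) * jain_T n r \<beta> y)
      = (\<lambda>y. \<Sum>j. Q j * jain_L n \<beta> (Suc j) y)"
    proof
    fix y
    have "(\<lambda>j. Q j * jain_L n \<beta> (Suc j) y) =
      (\<lambda>j. real n * (1 - \<beta>) * (jain_P n (r + 1) j \<beta> * jain_L n \<beta> (Suc j) y)
        + \<beta> * (real r + 2) * (jain_P n r j \<beta> * jain_L n \<beta> (Suc j) y))"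
      by (simp only: Q_def distrib_right mult.assoc)
    then show "real n * (1 - \<beta>) * jain_T n (r + 1) \<beta> y + \<beta> * (real r + 2) * jain_T n r \<beta> y
        = (\<Sum>j. Q j * jain_L n \<beta> (Suc j) y)"
      by (simp only:) (intro sums_unique sums_add sT)
  qed
  have left: "(\<lambda>y. (real n)\<^sup>2 * jain_T n (r + 2) \<beta> y - real n * (real r + \<beta> + 1) * jain_T n (r + 1) \<beta> y
        + \<beta> * (real r + 2) * jain_T n r \<beta> y)
      = (\<lambda>y. \<Sum>j. K j * jain_L n \<beta> (Suc j) y)"
  proof
    fix y
    have "(\<lambda>j. K j * jain_L n \<beta> (Suc j) y) =
      (\<lambda>j. (real n)\<^sup>2 * (jain_P n (r + 2) j \<beta> * jain_L n \<beta> (Suc j) y)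
        - real n * (real r + \<beta> + 1) * (jain_P n (r + 1) j \<beta> * jain_L n \<beta> (Suc j) y)
        + \<beta> * (real r + 2) * (jain_P n r j \<beta> * jain_L n \<beta> (Suc j) y))"
      by (simp only: K distrib_right left_diff_distrib mult.assoc)
    then show "(real n)\<^sup>2 * jain_T n (r + 2) \<beta> y - real n * (real r + \<beta> + 1) * jain_T n (r + 1) \<beta> y
        + \<beta> * (real r + 2) * jain_T n r \<beta> y = (\<Sum>j. K j * jain_L n \<beta> (Suc j) y)"
      by (simp only:) (intro sums_unique sums_add sums_diff sT)
  qed
  have "jain_op n \<beta> (\<lambda>y. \<Sum>j. K j * jain_L n \<beta> (Suc j) y) x
      = real n * x\<^sup>2 * D_plus (real n) (\<lambda>y. \<Sum>j. Q j * jain_L n \<beta> (Suc j) y) x"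
    if x: "x \<ge> 0" for x
  proof -
    have termwise: "- \<beta> * x * (K j * jain_dL n \<beta> j x + real n * (K j * jain_L n \<beta> (Suc j) x))
        + (real n * x + \<beta>) * (K j * jain_L n \<beta> (Suc j) x)
      = real n * x\<^sup>2 * (Q j * jain_dL n \<beta> j x + real n * (Q j * jain_L n \<beta> (Suc j) x))" for j
    proof -
      have "x * (real n * x + (1 + real j) * \<beta>) * (jain_dL n \<beta> j x + real n * jain_L n \<beta> (Suc j) x)
         = (1 + real j) * (real n * x + \<beta>) * jain_L n \<beta> (Suc j) x"
        using jain_L_dL_identity[of x n j \<beta>] by simp
      \<comment> \<open>The two terms in which D + n acts combine through n x^2 + \<beta> x (j + 1)
        = x v, so the difference of the two sides is \<open>Q j\<close> times the difference of the
        sides of \<open>jain_L_dL_identity\<close>.\<close>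
      moreover have "real n * x\<^sup>2 * (Q j * jain_dL n \<beta> j x + real n * (Q j * jain_L n \<beta> (Suc j) x))
          - (- \<beta> * x * (K j * jain_dL n \<beta> j x + real n * (K j * jain_L n \<beta> (Suc j) x))
             + (real n * x + \<beta>) * (K j * jain_L n \<beta> (Suc j) x))
        = Q j * (x * (real n * x + (1 + real j) * \<beta>) * (jain_dL n \<beta> j x + real n * jain_L n \<beta> (Suc j) x)
             - (1 + real j) * (real n * x + \<beta>) * jain_L n \<beta> (Suc j) x)"
        unfolding K_def by (simp add: algebra_simps power2_eq_square)
      ultimately show ?thesis by simp
    qed
    have sL: "(\<lambda>j. K j * jain_L n \<beta> (Suc j) x) sums (\<Sum>j. K j * jain_L n \<beta> (Suc j) x)"
      "(\<lambda>j. K j * jain_dL n \<beta> j x) sums (\<Sum>j. K j * jain_dL n \<beta> j x)"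
      "(\<lambda>j. Q j * jain_L n \<beta> (Suc j) x) sums (\<Sum>j. Q j * jain_L n \<beta> (Suc j) x)"
      "(\<lambda>j. Q j * jain_dL n \<beta> j x) sums (\<Sum>j. Q j * jain_dL n \<beta> j x)"
      using S[OF gK] S'[OF gK] S[OF gQ] S'[OF gQ] by (simp_all add: summable_sums)
    have "(\<lambda>j. - \<beta> * x * (K j * jain_dL n \<beta> j x + real n * (K j * jain_L n \<beta> (Suc j) x))
        + (real n * x + \<beta>) * (K j * jain_L n \<beta> (Suc j) x)) sums
      (- \<beta> * x * ((\<Sum>j. K j * jain_dL n \<beta> j x) + real n * (\<Sum>j. K j * jain_L n \<beta> (Suc j) x))
        + (real n * x + \<beta>) * (\<Sum>j. K j * jain_L n \<beta> (Suc j) x))"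
      by (intro sums_add sums_mult sL)
    moreover have "(\<lambda>j. real n * x\<^sup>2 * (Q j * jain_dL n \<beta> j x + real n * (Q j * jain_L n \<beta> (Suc j) x))) sums
      (real n * x\<^sup>2 * ((\<Sum>j. Q j * jain_dL n \<beta> j x) + real n * (\<Sum>j. Q j * jain_L n \<beta> (Suc j) x)))"
      by (intro sums_add sums_mult sL)
    ultimately have "- \<beta> * x * ((\<Sum>j. K j * jain_dL n \<beta> j x) + real n * (\<Sum>j. K j * jain_L n \<beta> (Suc j) x))
        + (real n * x + \<beta>) * (\<Sum>j. K j * jain_L n \<beta> (Suc j) x)
      = real n * x\<^sup>2 * ((\<Sum>j. Q j * jain_dL n \<beta> j x) + real n * (\<Sum>j. Q j * jain_L n \<beta> (Suc j) x))"
      unfolding termwise by (rule sums_unique2)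
    then show ?thesis
      unfolding jain_op_def D_plus_def D_half_jain_series[OF assms(1,2) gK x]
        D_half_jain_series[OF assms(1,2) gQ x]
      by (simp add: algebra_simps)
  qed
  moreover have "jain_T n s \<beta> differentiable_on {0..}" for s
    unfolding differentiable_on_def jain_T_def[abs_def]
    using has_real_derivative_jain_series[OF assms(1,2) growth]
    by (blast intro: differentiableI has_field_derivative_imp_has_derivative differentiable_at_withinI)
  ultimately show ?thesis
    unfolding left right using S[OF growth] by simp
qed

end
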